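(* Let $q>2$ be a prime power, let $\mathbb{F}_q$ be the finite field with $q$ elements, let $t\in\mathbb{F}_q^*$, and let $f=\mathtt{x}^{q-2}+t\,\mathtt{x}^{q^2-q-1}\in\mathbb{F}_q[\mathtt{x}]$. Then $f$ is a permutation polynomial of $\mathbb{F}_{q^2}$ if and only if one of the following occurs: (i) $t=1$ and $q\equiv 1\pmod 4$; (ii) $t=-3$ and $q\equiv \pm 1\pmod{12}$; (iii) $t=3$ and $q\equiv -1\pmod 6$.
   Context: A polynomial $f$ with coefficients in a finite field $F$ is called a permutation polynomial of $F$ if the map $F\to F$, $x\mapsto f(x)$, is a permutation of $F$; here $f\in\mathbb{F}_q[\mathtt{x}]$ is viewed as a polynomial over $\mathbb{F}_{q^2}\supset\mathbb{F}_q$. The equalities $t=1$, $t=-3$, $t=3$ are in $\mathbb{F}_q$ (integers are read as their images in $\mathbb{F}_q$). *)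

theory Defs
  imports
    "HOL-Library.Cardinality"
    "HOL-Number_Theory.Number_Theory"
    "HOL-Computational_Algebra.Computational_Algebra"
    "Jordan_Normal_Form.Ring_Hom_Matrix"
begin

definition permutation_polynomial :: "'a :: finite_field poly \<Rightarrow> bool" where
  "permutation_polynomial f \<longleftrightarrow> bij (poly f)"

end

theory Submission
  imports Defs
begin

text \<open>
  Replacing \<open>x\<close> by \<open>1/x\<close> turns \<open>f\<close> into \<open>h(x) = x (1 + t z\<^sup>2) / z\<close> with \<open>z = x\<^sup>q\<^sup>-\<^sup>1\<close>, and then
  \<open>h(x)\<^sup>q\<^sup>-\<^sup>1 = g(z)\<close> for \<open>g(z) = z (z\<^sup>2 + t) / (1 + t z\<^sup>2)\<close>. So the question is whether \<open>g\<close> permutes the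
  group of \<open>(q+1)\<close>-th roots of unity.

  If \<open>h\<close> is bijective, then the sum of \<open>h(x)\<^sup>2\<^sup>(\<^sup>q\<^sup>-\<^sup>1\<^sup>)\<close> over all nonzero \<open>x\<close> equals that of \<open>x\<^sup>2\<^sup>(\<^sup>q\<^sup>-\<^sup>1\<^sup>)\<close>, which
  is zero. As a function of \<open>y = z\<^sup>2\<close> the summand has a single, double, pole at \<open>a = -1/t\<close>, and its
  partial fractions can be summed explicitly. For \<open>t\<^sup>2 \<noteq> 1\<close> the result vanishes only
  if \<open>q\<close> is odd and \<open>t = -3 \<epsilon>\<close>, where \<open>\<epsilon> = (-t)\<^sup>(\<^sup>q\<^sup>-\<^sup>1\<^sup>)\<^sup>/\<^sup>2\<close>; the congruences on \<open>q\<close> express when \<open>3\<close> or \<open>-3\<close>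
  is a square. Conversely, in these two cases \<open>g(z) = g(w)\<close> with \<open>z \<noteq> w\<close> means
  \<open>(z - w)\<^sup>2 = \<plusminus>3 (zw \<plusminus> 1)\<^sup>2\<close>, and raising to the \<open>q\<close>-th power contradicts the quadratic
  character of \<open>\<plusminus>3\<close>.
\<close>

section \<open>Power sums over a finite field\<close>

lemma finite_field_power_card_minus_1:
  fixes x :: "'a :: finite_field"
  assumes "x \<noteq> 0"
  shows "x ^ (CARD('a) - 1) = 1"
proof -
  obtain n where "CARD('a) = Suc n"
    using finite_UNIV_card_ge_0[where 'a='a] by (cases "CARD('a)") auto
  thus ?thesis using finite_field_power_card_eq_same[of x] assms by simp
qed

text \<open>\<open>monom 1 k - 1\<close> has at most \<open>k\<close> roots, fewer than there are
  nonzero elements.\<close>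

lemma ex_power_neq_1:
  assumes "0 < k" "k < CARD('a :: finite_field) - 1"
  shows "\<exists>c :: 'a. c \<noteq> 0 \<and> c ^ k \<noteq> 1"
proof (rule ccontr)
  assume "\<not> ?thesis"
  hence sub: "-{0} \<subseteq> {c :: 'a. poly (monom 1 k - 1) c = 0}"
    by (auto simp: poly_monom)
  have deg: "degree (monom 1 k - 1 :: 'a poly) = k"
    using assms(1) by (subst diff_conv_add_uminus, subst degree_add_eq_left) (auto simp: degree_monom_eq)
  hence "monom 1 k - 1 \<noteq> (0 :: 'a poly)" using assms(1) by auto
  from card_poly_roots_bound[OF this] have "card {c :: 'a. poly (monom 1 k - 1) c = 0} \<le> k"
    by (simp only: deg)
  moreover have "card (-{0 :: 'a}) = CARD('a) - 1"
    by (simp add: Compl_eq_Diff_UNIV)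
  ultimately show False
    using card_mono[OF _ sub] assms(2) by simp
qed

text \<open>Substituting \<open>c * x\<close> for \<open>x\<close> multiplies the sum by
  \<open>c ^ k\<close>, and \<open>c\<close> can be chosen with \<open>c ^ k\<close> different from
  1.\<close>

lemma sum_power_nonzero:
  assumes "\<not> (CARD('a :: finite_field) - 1) dvd k"
  shows "(\<Sum>x \<in> -{0 :: 'a}. x ^ k) = 0"
proof -
  define n where "n = CARD('a) - 1"
  have "n > 0"
    using finite_UNIV_card_ge_0[where 'a='a] card_mono[of UNIV "{0,1::'a}"] by (simp add: n_def)
  then obtain c :: 'a where c: "c \<noteq> 0" "c ^ (k mod n) \<noteq> 1"
    using ex_power_neq_1[of "k mod n", where 'a='a] assms by (auto simp: n_def mod_greater_zero_iff_not_dvd)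
  have "c ^ k = (c ^ n) ^ (k div n) * c ^ (k mod n)"
    by (simp flip: power_mult power_add)
  hence ck: "c ^ k \<noteq> 1"
    using c finite_field_power_card_minus_1[OF c(1)] by (simp add: n_def)
  have "(\<Sum>x \<in> -{0 :: 'a}. x ^ k) = (\<Sum>x \<in> -{0}. (c * x) ^ k)"
    by (rule sum.reindex_bij_witness[of _ "\<lambda>x. c * x" "\<lambda>x. x / c"]) (use c in auto)
  also have "\<dots> = c ^ k * (\<Sum>x \<in> -{0 :: 'a}. x ^ k)"
    by (simp add: power_mult_distrib sum_distrib_left)
  finally show ?thesis using ck by simp
qed

section \<open>Sums of rational functions of roots of unity\<close>

text \<open>Since \<open>y x ^ m = 1\<close>, a geometric sum turns \<open>1 / (a - y x)\<close>
  into a polynomial in \<open>y x\<close> over \<open>a ^ m - 1\<close>. After summation over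
  \<open>S\<close> only the exponent divisible by \<open>m\<close> contributes.\<close>

lemma sum_power_div_diff:
  fixes y :: "'i \<Rightarrow> 'a :: field"
  assumes ym: "\<And>x. x \<in> S \<Longrightarrow> y x ^ m = 1"
    and sum0: "\<And>k. 0 < k \<Longrightarrow> k < m \<Longrightarrow> (\<Sum>x\<in>S. y x ^ k) = 0"
    and "a ^ m \<noteq> 1" "k < m"
  shows "(\<Sum>x\<in>S. y x ^ k / (a - y x)) =
           of_nat (card S) * a ^ (if k = 0 then m - 1 else k - 1) / (a ^ m - 1)"
proof -
  \<comment> \<open>For \<open>i < m\<close>, the exponent \<open>m - 1 - i + k\<close> is a
    multiple of \<open>m\<close> only at \<open>i = j\<close>: it is then 0 if \<open>k = 0\<close>,
    and \<open>m\<close> otherwise.\<close>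
  define j where "j = (if k = 0 then m - 1 else k - 1)"
  have jm: "j < m" using assms(4) by (auto simp: j_def)
  have "y x ^ k / (a - y x) = (\<Sum>i<m. a ^ i * y x ^ (m - 1 - i + k)) / (a ^ m - 1)"
    if "x \<in> S" for x
  proof -
    have "a ^ m - 1 = a ^ m - y x ^ m" using ym that by simp
    also have "\<dots> = (a - y x) * (\<Sum>i<m. a ^ i * y x ^ (m - 1 - i))"
      by (subst power_diff_sumr2) (simp add: mult.commute)
    finally have eq: "a ^ m - 1 = (a - y x) * (\<Sum>i<m. a ^ i * y x ^ (m - 1 - i))" .
    moreover have "(\<Sum>i<m. a ^ i * y x ^ (m - 1 - i + k)) = y x ^ k * (\<Sum>i<m. a ^ i * y x ^ (m - 1 - i))"
      unfolding sum_distrib_left by (simp only: power_add mult_ac)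
    ultimately show ?thesis using assms(3) by auto
  qed
  hence "(\<Sum>x\<in>S. y x ^ k / (a - y x))
       = (\<Sum>x\<in>S. \<Sum>i<m. a ^ i * y x ^ (m - 1 - i + k)) / (a ^ m - 1)"
    by (simp add: sum_divide_distrib)
  also have "(\<Sum>x\<in>S. \<Sum>i<m. a ^ i * y x ^ (m - 1 - i + k))
       = (\<Sum>i<m. a ^ i * (\<Sum>x\<in>S. y x ^ (m - 1 - i + k)))"
    by (subst sum.swap) (simp add: sum_distrib_left)
  also have "\<dots> = (\<Sum>i<m. if i = j then a ^ i * of_nat (card S) else 0)"
  proof (rule sum.cong[OF refl])
    fix i assume i: "i \<in> {..<m}"
    have "(\<Sum>x\<in>S. y x ^ (m - 1 - i + k)) = (if i = j then of_nat (card S) else 0)"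
    proof (cases "i = j")
      case True
      hence "m - 1 - i + k = (if k = 0 then 0 else m)"
        using assms(4) by (auto simp: j_def)
      thus ?thesis using ym True by auto
    next
      case False
      show ?thesis
      proof (cases "m - 1 - i + k < m")
        case True
        thus ?thesis using sum0[of "m - 1 - i + k"] i False
          by (auto simp: j_def split: if_splits)
      next
        case ge: False
        then obtain l where l: "m - 1 - i + k = m + l" by (metis le_Suc_ex not_le)
        hence k: "k = l + i + 1" using i by auto
        hence "l \<noteq> 0" using False by (auto simp: j_def)
        hence "0 < l" "l < m" using k assms(4) by simp_all
        moreover have "(\<Sum>x\<in>S. y x ^ (m - 1 - i + k)) = (\<Sum>x\<in>S. y x ^ l)"
          unfolding l by (intro sum.cong refl) (simp add: power_add ym)
        ultimately show ?thesis using False sum0 by simp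
      qed
    qed
    thus "a ^ i * (\<Sum>x\<in>S. y x ^ (m - 1 - i + k)) = (if i = j then a ^ i * of_nat (card S) else 0)"
      by simp
  qed
  also have "\<dots> = of_nat (card S) * a ^ j" using jm by simp
  finally show ?thesis by (simp add: j_def)
qed

text \<open>Only one factor of \<open>1 / (a - y x) ^ 2\<close> is expanded;
  \<open>sum_power_div_diff\<close> sums what remains.\<close>

lemma sum_inverse_diff_square:
  fixes y :: "'i \<Rightarrow> 'a :: field"
  assumes ym: "\<And>x. x \<in> S \<Longrightarrow> y x ^ m = 1"
    and sum0: "\<And>k. 0 < k \<Longrightarrow> k < m \<Longrightarrow> (\<Sum>x\<in>S. y x ^ k) = 0"
    and am: "a ^ m \<noteq> 1" and m: "m \<ge> 2"
  shows "(\<Sum>x\<in>S. 1 / (a - y x) ^ 2) =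
           of_nat (card S) * (of_nat (m - 1) * a ^ (m - 2) + a ^ (2 * m - 2)) / (a ^ m - 1) ^ 2"
proof -
  define c where "c = (of_nat (card S) :: 'a)"
  have eq: "1 / (a - y x) ^ 2 = (\<Sum>i<m. a ^ i * (y x ^ (m - 1 - i) / (a - y x))) / (a ^ m - 1)"
    if "x \<in> S" for x
  proof -
    have "a ^ m - 1 = a ^ m - y x ^ m" using ym that by simp
    also have "\<dots> = (a - y x) * (\<Sum>i<m. a ^ i * y x ^ (m - 1 - i))"
      by (subst power_diff_sumr2) (simp add: mult.commute)
    finally have eq: "a ^ m - 1 = (a - y x) * (\<Sum>i<m. a ^ i * y x ^ (m - 1 - i))" .
    moreover have "(\<Sum>i<m. a ^ i * (y x ^ (m - 1 - i) / (a - y x)))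
        = (\<Sum>i<m. a ^ i * y x ^ (m - 1 - i)) / (a - y x)"
      by (simp add: sum_divide_distrib)
    ultimately show ?thesis using am by (auto simp: power2_eq_square)
  qed
  have "(\<Sum>x\<in>S. 1 / (a - y x) ^ 2)
      = (\<Sum>i<m. a ^ i * (\<Sum>x\<in>S. y x ^ (m - 1 - i) / (a - y x))) / (a ^ m - 1)"
    by (simp only: eq sum_divide_distrib[symmetric] sum_distrib_left sum.swap[of _ _ S] cong: sum.cong)
  also have "(\<Sum>i<m. a ^ i * (\<Sum>x\<in>S. y x ^ (m - 1 - i) / (a - y x)))
      = (\<Sum>i<m. c * (if i = m - 1 then a ^ (2 * m - 2) else a ^ (m - 2)) / (a ^ m - 1))"
  proof (rule sum.cong[OF refl])
    fix i assume i: "i \<in> {..<m}"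
    \<comment> \<open>Only \<open>i = m - 1\<close> meets the exceptional case \<open>k = 0\<close>
      of \<open>sum_power_div_diff\<close>; all other \<open>i\<close> give the same power.\<close>
    have *: "a ^ i * a ^ (if m - 1 - i = 0 then m - 1 else m - 1 - i - 1)
       = (if i = m - 1 then a ^ (2 * m - 2) else a ^ (m - 2))"
      using i m by (auto simp flip: power_add intro!: arg_cong[of _ _ "\<lambda>n. a ^ n"])
    have "(\<Sum>x\<in>S. y x ^ (m - 1 - i) / (a - y x))
       = c * a ^ (if m - 1 - i = 0 then m - 1 else m - 1 - i - 1) / (a ^ m - 1)"
      unfolding c_def using i m by (intro sum_power_div_diff[OF ym sum0 am]) auto
    thus "a ^ i * (\<Sum>x\<in>S. y x ^ (m - 1 - i) / (a - y x))
       = c * (if i = m - 1 then a ^ (2 * m - 2) else a ^ (m - 2)) / (a ^ m - 1)"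
      by (simp only: * [symmetric] times_divide_eq_right mult.left_commute)
  qed
  also have "\<dots> = c * (\<Sum>i<m. if i = m - 1 then a ^ (2 * m - 2) else a ^ (m - 2)) / (a ^ m - 1)"
    by (simp add: sum_distrib_left sum_divide_distrib)
  also have "(\<Sum>i<m. if i = m - 1 then a ^ (2 * m - 2) else a ^ (m - 2))
      = of_nat (m - 1) * a ^ (m - 2) + a ^ (2 * m - 2)"
  proof -
    obtain n where "m = Suc n" using m by (cases m) auto
    thus ?thesis by simp
  qed
  finally show ?thesis by (simp add: c_def power2_eq_square)
qed

text \<open>Summing the partial fractions in \<open>y x\<close> gives a nonzero multiple of
  \<open>b * (b * of_nat m * A - 2 * a * (A - 1))\<close>, where \<open>b = a + T\<close> and
  \<open>A = a ^ m\<close>.\<close>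

lemma sum_rational_eq_0_imp:
  fixes y :: "'i \<Rightarrow> 'a :: field"
  assumes ym: "\<And>x. x \<in> S \<Longrightarrow> y x ^ m = 1"
    and sum0: "\<And>k. 0 < k \<Longrightarrow> k < m \<Longrightarrow> (\<Sum>x\<in>S. y x ^ k) = 0"
    and am: "a ^ m \<noteq> 1" and m: "m \<ge> 2"
    and c: "of_nat (card S) \<noteq> (0 :: 'a)"
    and aT: "a * T = -1"
    and sum: "(\<Sum>x\<in>S. y x * (y x + T) ^ 2 / (1 + T * y x) ^ 2) = 0"
  shows "a + T = 0 \<or> (a + T) * of_nat m * a ^ m = 2 * a * (a ^ m - 1)"
proof -
  define b where "b = a + T"
  define A where "A = a ^ m"
  define c where "c = (of_nat (card S) :: 'a)"
  have a0: "a \<noteq> 0" "T \<noteq> 0" using aT by auto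
  have A1: "A - 1 \<noteq> 0" using am by (simp add: A_def)
  \<comment> \<open>With \<open>u = a - y x\<close> one has \<open>y x + T = b - u\<close>; expand
    and divide by \<open>u ^ 2\<close>. The factor \<open>y x ^ 0\<close> lets
    \<open>sum_power_div_diff\<close> apply with \<open>k = 0\<close>.\<close>
  have dec: "y x * (y x + T) ^ 2 / (1 + T * y x) ^ 2 =
      (y x + 2 * b - (b\<^sup>2 + 2 * a * b) * (y x ^ 0 / (a - y x)) + a * b ^ 2 * (1 / (a - y x) ^ 2)) / T ^ 2"
    if "x \<in> S" for x
  proof -
    have ne: "a - y x \<noteq> 0" using ym[OF that] am by auto
    have "1 + T * y x = - T * (a - y x)" using aT by (simp add: algebra_simps)
    hence "y x * (y x + T) ^ 2 / (1 + T * y x) ^ 2 = y x * (y x + T) ^ 2 / (a - y x) ^ 2 / T ^ 2"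
      by (simp add: power_mult_distrib)
    also have "y x * (y x + T) ^ 2 / (a - y x) ^ 2 =
      y x + 2 * b - (b\<^sup>2 + 2 * a * b) * (y x ^ 0 / (a - y x)) + a * b ^ 2 * (1 / (a - y x) ^ 2)"
      using ne by (simp add: b_def divide_simps) (simp add: algebra_simps power2_eq_square power3_eq_cube)
    finally show ?thesis .
  qed
  have s1: "(\<Sum>x\<in>S. y x) = 0" using sum0[of 1] m by simp
  have s2: "(\<Sum>x\<in>S. y x ^ 0 / (a - y x)) = c * A / (a * (A - 1))"
    using m a0 by (subst sum_power_div_diff[OF ym sum0 am]) (auto simp: A_def c_def power_diff)
  have "m = 2 + (m - 2)" "m + m = 2 + (2 * m - 2)" using m by auto
  hence e: "a ^ m = a ^ 2 * a ^ (m - 2)" "a ^ m * a ^ m = a ^ 2 * a ^ (2 * m - 2)"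
    by (metis power_add)+
  hence s3: "(\<Sum>x\<in>S. 1 / (a - y x) ^ 2) = c * (of_nat (m - 1) * A + A * A) / (a ^ 2 * (A - 1) ^ 2)"
    using a0 A1 m by (subst sum_inverse_diff_square[OF ym sum0 am m])
      (auto simp: A_def c_def field_simps)
  have "0 = (\<Sum>x\<in>S. (y x + 2 * b - (b\<^sup>2 + 2 * a * b) * (y x ^ 0 / (a - y x)) +
          a * b ^ 2 * (1 / (a - y x) ^ 2)) / T ^ 2)"
    using sum dec by simp
  also have "\<dots> = ((\<Sum>x\<in>S. y x) + 2 * b * c - (b\<^sup>2 + 2 * a * b) * (\<Sum>x\<in>S. y x ^ 0 / (a - y x))
      + a * b ^ 2 * (\<Sum>x\<in>S. 1 / (a - y x) ^ 2)) / T ^ 2"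
    by (simp only: sum.distrib sum_subtractf sum_divide_distrib[symmetric] sum_distrib_left[symmetric]
         sum_constant c_def mult.commute[of "of_nat (card S)"] mult.assoc)
  finally have "0 = 2 * b * c - (b\<^sup>2 + 2 * a * b) * (c * A / (a * (A - 1)))
      + a * b ^ 2 * (c * (of_nat (m - 1) * A + A * A) / (a ^ 2 * (A - 1) ^ 2))"
    unfolding s1 s2 s3 using a0 by simp
  also have "\<dots> = c * b * (b * of_nat m * A - 2 * a * (A - 1)) / (a * (A - 1) ^ 2)"
    using a0 A1 m by (simp add: divide_simps of_nat_diff) (simp add: algebra_simps power2_eq_square)
  finally have "b = 0 \<or> b * of_nat m * A = 2 * a * (A - 1)"
    using a0 A1 assms(5) by (auto simp: c_def)
  thus ?thesis by (simp add: b_def A_def)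
qed

lemma coprime_6_mod_12:
  fixes q :: nat
  assumes "odd q" "\<not> 3 dvd q" 
  shows "q mod 12 = 1 \<and> q mod 4 = 1 \<and> q mod 6 = 1 \<or> q mod 12 = 5 \<and> q mod 4 = 1 \<and> q mod 6 = 5
     \<or> q mod 12 = 7 \<and> q mod 4 = 3 \<and> q mod 6 = 1 \<or> q mod 12 = 11 \<and> q mod 4 = 3 \<and> q mod 6 = 5"
proof -
  define r where "r = q mod 12"
  have "r < 12" "odd r" "\<not> 3 dvd r"
    using assms unfolding r_def by (simp_all add: dvd_mod_iff)
  hence "r = 1 \<or> r = 5 \<or> r = 7 \<or> r = 11"
    by presburger
  moreover have "q mod 4 = r mod 4" "q mod 6 = r mod 6" by (simp_all add: r_def mod_mod_cancel)
  ultimately show ?thesis unfolding r_def[symmetric] by (elim disjE) simp_all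
qed

section \<open>Frobenius arithmetic in the field with \<open>q ^ 2\<close> elements\<close>

text \<open>
  Here \<open>T\<close> is the image of \<open>t\<close> in the field with \<open>q\<^sup>2\<close> elements; being in the subfield is
  encoded by \<open>T\<^sup>q = T\<close>.
\<close>
locale twisted_cubic =
  fixes q :: nat and T :: "'b :: finite_field"
  assumes primepow_q: "primepow q" and q_gt_2: "q > 2"
    and card_eq: "CARD('b) = q ^ 2"
    and T_power: "T ^ q = T" and T_nonzero: "T \<noteq> 0"
begin

text \<open>Division by zero makes \<open>h 0 = 0\<close>, which agrees with the value of the
  polynomial at 0.\<close>

definition h :: "'b \<Rightarrow> 'b" where
  "h x = x * (1 + T * (x ^ (q - 1)) ^ 2) / x ^ (q - 1)"

text \<open>The characteristic divides the cardinality \<open>q ^ 2\<close>, so it is the prime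
  underlying \<open>q\<close>. This makes the \<open>q\<close>-th power map additive.\<close>

lemma q_eq_CHAR_power: "\<exists>n>0. q = CHAR('b) ^ n"
proof -
  obtain p n where pn: "prime p" "n > 0" "q = p ^ n"
    using primepow_q by (auto simp: primepow_def)
  have pc: "prime CHAR('b)" by (rule prime_CHAR_semidom) (rule CHAR_pos)
  have "CHAR('b) dvd q ^ 2" using CHAR_dvd_CARD[where 'a='b] by (simp add: card_eq)
  hence "CHAR('b) dvd p" using pn pc prime_dvd_power by blast
  hence "CHAR('b) = p" using pc pn(1) primes_dvd_imp_eq by blast
  thus ?thesis using pn by auto
qed

lemma of_nat_prime_eq_0_iff:
  assumes "prime p"
  shows "of_nat p = (0 :: 'b) \<longleftrightarrow> p dvd q"
proof -
  have pc: "prime CHAR('b)" by (rule prime_CHAR_semidom) (rule CHAR_pos)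
  obtain n where n: "n > 0" "q = CHAR('b) ^ n" using q_eq_CHAR_power by blast
  have "p dvd q \<longleftrightarrow> p dvd CHAR('b)"
    using n assms by (auto dest: prime_dvd_power intro: dvd_trans[OF _ dvd_power])
  thus ?thesis
    using assms pc by (metis of_nat_eq_0_iff_char_dvd primes_dvd_imp_eq)
qed

lemma two_eq_0_iff: "(2 :: 'b) = 0 \<longleftrightarrow> even q"
  using of_nat_prime_eq_0_iff[of 2] by simp

lemma three_eq_0_iff: "(3 :: 'b) = 0 \<longleftrightarrow> 3 dvd q"
  using of_nat_prime_eq_0_iff[of 3] by simp

lemma of_nat_q: "of_nat q = (0 :: 'b)"
  using q_eq_CHAR_power by auto

lemma frob_add: "(x + y) ^ q = x ^ q + (y :: 'b) ^ q"
proof -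
  have pc: "prime CHAR('b)" by (rule prime_CHAR_semidom) (rule CHAR_pos)
  thus ?thesis using q_eq_CHAR_power freshmans_dream' by blast
qed

text \<open>Derived from additivity rather than from the parity of \<open>q\<close>, so that even
  \<open>q\<close> is covered.\<close>

lemma frob_minus: "(- x) ^ q = - ((x :: 'b) ^ q)"
proof -
  have "x ^ q + (- x) ^ q = 0"
    using q_gt_2 by (simp flip: frob_add)
  thus ?thesis by (simp add: eq_neg_iff_add_eq_0 add.commute)
qed

lemma frob_diff: "(x - y) ^ q = x ^ q - (y :: 'b) ^ q"
  using frob_add[of x "-y"] by (simp add: frob_minus)

lemma card_minus_1: "CARD('b) - 1 = (q - 1) * (q + 1)"
  by (simp add: card_eq power2_eq_square algebra_simps)

lemma norm_1:
  assumes "x \<noteq> (0 :: 'b)"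
  shows "(x ^ (q - 1)) ^ (q + 1) = 1"
  using finite_field_power_card_minus_1[OF assms]
  by (simp only: card_minus_1 power_mult)

lemma power_q_eq: "x ^ q = x * x ^ (q - 1)" for x :: 'b
  using q_gt_2 by (cases q) auto

lemma inverse_eq_frob:
  assumes "z ^ (q + 1) = (1 :: 'b)"
  shows "z ^ q = inverse z" "z \<noteq> 0"
proof -
  show "z \<noteq> 0" using assms by (metis power_0_left add_is_0 one_neq_zero zero_neq_one)
  thus "z ^ q = inverse z" using assms by (simp add: field_simps)
qed

section \<open>Reduction to a map on roots of unity\<close>

text \<open>Inversion permutes the field and \<open>F (inverse x) = h x\<close>: for nonzero
  \<open>x\<close>, the \<open>(q ^ 2 - 1)\<close>-th power is 1, so
  \<open>inverse x ^ (q ^ 2 - q - 1)\<close> equals \<open>x ^ q\<close>.\<close>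

lemma bij_iff:
  assumes "\<And>x. F x = x ^ (q - 2) + T * x ^ (q ^ 2 - q - 1)"
  shows "bij F \<longleftrightarrow> bij h"
proof -
  have Fh: "F (inverse x) = h x" for x
  proof (cases "x = 0")
    case True
    have "q ^ 2 = q * q" "q * q \<ge> q * 3"
      using q_gt_2 by (auto simp: power2_eq_square)
    hence "q ^ 2 - q - 1 > 0" using q_gt_2 by linarith
    thus ?thesis using True q_gt_2 by (simp add: assms h_def power_0_left del: diff_diff_left)
  next
    case False
    have "x ^ (q - 1) = x ^ (q - 2) * x"
      using q_gt_2 by (simp flip: power_Suc2 add: Suc_diff_Suc numeral_2_eq_2)
    hence 1: "inverse x ^ (q - 2) = x / x ^ (q - 1)"
      using False by (simp add: field_simps)
    have "q ^ 2 = q * q" "q * q \<ge> q * 3"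
      using q_gt_2 by (auto simp: power2_eq_square)
    hence "q ^ 2 - q - 1 + q = CARD('b) - 1" unfolding card_eq using q_gt_2 by linarith
    hence "x ^ (q ^ 2 - q - 1) * x ^ q = 1"
      using finite_field_power_card_minus_1[OF False] by (metis power_add)
    hence 2: "inverse x ^ (q ^ 2 - q - 1) = x * x ^ (q - 1)"
      using False by (simp add: power_q_eq field_simps)
    show ?thesis using False unfolding assms 1 2 h_def
      by (simp add: field_simps power2_eq_square)
  qed
  have inv: "bij (inverse :: 'b \<Rightarrow> 'b)" by (rule involuntory_imp_bij) simp
  have "h = F \<circ> inverse" "F = h \<circ> inverse" by (auto simp: Fh fun_eq_iff simp flip: Fh)
  thus ?thesis using inv by (metis bij_comp)
qed

text \<open>Frobenius fixes \<open>T\<close> and inverts \<open>z\<close>. Compared with the formula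
  for \<open>h x\<close>, this yields \<open>h x ^ (q - 1)\<close>, yet it stays valid where
  \<open>h x = 0\<close>.\<close>

lemma h_frob:
  assumes "x \<noteq> 0" defines "z \<equiv> x ^ (q - 1)"
  shows "h x ^ q = x * (z ^ 2 + T)"
proof -
  have z: "z ^ q = inverse z" "z \<noteq> 0"
    using inverse_eq_frob[OF norm_1[OF assms(1)]] by (simp_all add: z_def)
  have "h x ^ q = x ^ q * (1 + T ^ q * (z ^ 2) ^ q) / z ^ q"
    unfolding h_def z_def[symmetric] by (simp add: frob_add power_mult_distrib power_divide)
  also have "(z ^ 2) ^ q = (z ^ q) ^ 2" by (simp add: mult.commute flip: power_mult)
  finally have "h x ^ q = x ^ q * (1 + T ^ q * (z ^ q) ^ 2) / z ^ q" .
  also have "\<dots> = x * z * (1 + T * inverse z ^ 2) * z"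
    unfolding power_q_eq[of x] z_def[symmetric] T_power z(1)
    by (simp add: divide_inverse)
  also have "\<dots> = x * (z ^ 2 + T * (inverse z * z) ^ 2)"
    by (simp only: power2_eq_square ring_distribs mult_ac mult_1_left)
  finally show ?thesis using z(2) by simp
qed

lemma h_eq_0_iff:
  assumes "x \<noteq> 0"
  shows "h x = 0 \<longleftrightarrow> 1 + T * (x ^ (q - 1)) ^ 2 = 0"
  using assms by (simp add: h_def)

text \<open>The expression assumed nonzero is the numerator of \<open>(g(z) - g(w)) / (z - w)\<close>.\<close>
lemma bij_hI:
  assumes nz: "\<And>z. z ^ (q + 1) = 1 \<Longrightarrow> 1 + T * z ^ 2 \<noteq> 0"
    and inj: "\<And>z w. z ^ (q + 1) = 1 \<Longrightarrow> w ^ (q + 1) = 1 \<Longrightarrow> z \<noteq> w \<Longrightarrow>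
       z ^ 2 + z * w + w ^ 2 + T + T * (z * w) ^ 2 - T ^ 2 * (z * w) \<noteq> 0"
  shows "bij h"
proof -
  have h0: "h x = 0 \<longleftrightarrow> x = 0" for x
    using h_eq_0_iff[of x] nz[OF norm_1[of x]] by (cases "x = 0") (auto simp: h_def)
  have "x = y" if eq: "h x = h y" for x y
  proof (cases "x = 0 \<or> y = 0")
    case True
    thus ?thesis using h0[of x] h0[of y] eq by auto
  next
    case False
    define z w where "z = x ^ (q - 1)" and "w = y ^ (q - 1)"
    have mu: "z ^ (q + 1) = 1" "w ^ (q + 1) = 1"
      using False norm_1 unfolding z_def w_def by blast+
    note ne = inverse_eq_frob(2)[OF mu(1)] inverse_eq_frob(2)[OF mu(2)]
    \<comment> \<open>This is the equality of the \<open>(q - 1)\<close>-th powers of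
      \<open>h x\<close> and \<open>h y\<close>, cross-multiplied.\<close>
    have "h x ^ q * h y = h y ^ q * h x" using eq by simp
    hence "x * (z ^ 2 + T) * (y * (1 + T * w ^ 2) / w) = y * (w ^ 2 + T) * (x * (1 + T * z ^ 2) / z)"
      using False h_frob[of x] h_frob[of y] by (simp add: h_def z_def w_def)
    hence "(x * y) * ((z ^ 2 + T) * (1 + T * w ^ 2) * z) = (x * y) * ((w ^ 2 + T) * (1 + T * z ^ 2) * w)"
      using ne by (simp add: divide_simps mult_ac)
    hence "(z ^ 2 + T) * (1 + T * w ^ 2) * z = (w ^ 2 + T) * (1 + T * z ^ 2) * w"
      using False by simp
    hence "(z - w) * (z ^ 2 + z * w + w ^ 2 + T + T * (z * w) ^ 2 - T ^ 2 * (z * w)) = 0"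
      by (simp add: algebra_simps power2_eq_square)
    hence "z = w" using inj[OF mu] by auto
    \<comment> \<open>Elements with the same \<open>z\<close> are scaled by the same nonzero
      factor.\<close>
    hence "x * ((1 + T * z ^ 2) / z) = y * ((1 + T * z ^ 2) / z)"
      using eq unfolding h_def z_def[symmetric] w_def[symmetric] by simp
    moreover have "(1 + T * z ^ 2) / z \<noteq> 0" using nz[OF mu(1)] ne by simp
    ultimately show "x = y" by (metis mult_right_cancel)
  qed
  hence "inj h" by (auto simp: inj_def)
  thus ?thesis by (simp add: bij_def finite_UNIV_inj_surj)
qed

section \<open>Necessary conditions from a power sum\<close>

lemma bij_h_nonzero:
  assumes "bij h" "x \<noteq> 0"
  shows "h x \<noteq> 0"
proof -
  have "h 0 = 0" by (simp add: h_def)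
  thus ?thesis using assms bij_is_inj[of h] by (metis injD)
qed

text \<open>A bijective \<open>h\<close> permutes the nonzero elements, so the sums of
  \<open>y (h x)\<close> and \<open>y x\<close> agree, and the latter vanishes. The parameter
  \<open>m\<close> stands for the order of the group of squares of \<open>(q + 1)\<close>-th roots
  of unity, which depends on the parity of \<open>q\<close>.\<close>

lemma bij_h_imp_eq:
  assumes bij: "bij h" and T2: "T ^ 2 \<noteq> 1" and aT: "a * T = -1"
    and am: "a ^ m \<noteq> 1" and m: "m \<ge> 2"
    and m1: "\<And>x :: 'b. x \<noteq> 0 \<Longrightarrow> ((x ^ (q - 1)) ^ 2) ^ m = 1"
    and ndvd: "\<And>k. 0 < k \<Longrightarrow> k < m \<Longrightarrow> \<not> (q + 1) dvd 2 * k"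
  shows "(a + T) * of_nat m * a ^ m = 2 * a * (a ^ m - 1)"
proof -
  define S where "S = -{0 :: 'b}"
  define y where "y x = (x ^ (q - 1)) ^ 2" for x :: 'b
  have power_y: "y x ^ k = x ^ ((q - 1) * (2 * k))" for x k
    by (simp only: y_def power_mult)
  have sum0: "(\<Sum>x\<in>S. y x ^ k) = 0" if k: "\<not> (q + 1) dvd 2 * k" for k
  proof -
    \<comment> \<open>Cancelling \<open>q - 1\<close> reduces divisibility by
      \<open>q ^ 2 - 1\<close> to divisibility of \<open>2 * k\<close> by
      \<open>q + 1\<close>.\<close>
    have "\<not> (CARD('b) - 1) dvd (q - 1) * (2 * k)"
      unfolding card_minus_1 using k q_gt_2 by (subst dvd_times_left_cancel_iff) auto
    thus ?thesis unfolding power_y S_def by (rule sum_power_nonzero)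
  qed
  have y_h: "y (h x) = y x * (y x + T) ^ 2 / (1 + T * y x) ^ 2" if "x \<in> S" for x
  proof -
    define z where "z = x ^ (q - 1)"
    have x: "x \<noteq> 0" using that by (simp add: S_def)
    have z: "z \<noteq> 0" using x by (simp add: z_def)
    have hx: "h x = x * (1 + T * z ^ 2) / z" by (simp add: h_def z_def)
    have nz: "1 + T * z ^ 2 \<noteq> 0"
      using bij_h_nonzero[OF bij x] h_eq_0_iff[OF x] by (simp add: z_def)
    have "h x * h x ^ (q - 1) = x * (z ^ 2 + T)"
      using h_frob[OF x] by (simp add: power_q_eq z_def)
    hence "x * (h x ^ (q - 1) * (1 + T * z ^ 2)) = x * (z * (z ^ 2 + T))"
      using z by (subst (asm) (1) hx) (simp add: field_simps)
    hence "h x ^ (q - 1) = z * (z ^ 2 + T) / (1 + T * z ^ 2)"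
      using x nz by (simp add: nonzero_eq_divide_eq)
    thus ?thesis unfolding y_def z_def[symmetric] by (simp add: power_mult_distrib power_divide)
  qed
  have "bij_betw h S S"
  proof (rule bij_betw_imageI)
    show inj: "inj_on h S" using bij_is_inj[OF bij] by (rule inj_on_subset) simp
    have "h x \<in> S" if "x \<in> S" for x
      using that bij_h_nonzero[OF bij, of x] by (simp add: S_def)
    hence "h ` S \<subseteq> S" by (rule image_subsetI)
    thus "h ` S = S" by (rule endo_inj_surj[OF finite _ inj])
  qed
  hence "(\<Sum>x\<in>S. y (h x)) = (\<Sum>x\<in>S. y x)" by (rule sum.reindex_bij_betw)
  also have "\<dots> = (\<Sum>x\<in>S. y x ^ 1)" by simp
  also have "\<dots> = 0" by (rule sum0) (use q_gt_2 dvd_imp_le[of "q + 1" 2] in force)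
  finally have "(\<Sum>x\<in>S. y x * (y x + T) ^ 2 / (1 + T * y x) ^ 2) = 0"
    by (simp add: y_h)
  moreover have "of_nat (card S) \<noteq> (0 :: 'b)"
  proof -
    have "card S + 1 = q ^ 2" unfolding S_def Compl_eq_Diff_UNIV
      by (simp add: card_eq) (use q_gt_2 in simp)
    hence "of_nat (card S) + (1 :: 'b) = of_nat (q ^ 2)" by (metis of_nat_1 of_nat_add)
    thus ?thesis by (auto simp: of_nat_q)
  qed
  ultimately have "a + T = 0 \<or> (a + T) * of_nat m * a ^ m = 2 * a * (a ^ m - 1)"
    using m1 ndvd sum0 am m aT
    by (intro sum_rational_eq_0_imp[where S = S and y = y]) (auto simp: S_def y_def)
  moreover have "a + T \<noteq> 0"
  proof
    assume "a + T = 0"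
    hence "a = -T" by (simp add: eq_neg_iff_add_eq_0)
    thus False using aT T2 by (simp add: power2_eq_square)
  qed
  ultimately show ?thesis by simp
qed

text \<open>As \<open>a\<close> lies in the subfield, \<open>a ^ m\<close> is \<open>a ^ 2\<close>
  for even \<open>q\<close> and \<open>a * e\<close> with \<open>e ^ 2 = 1\<close> for odd
  \<open>q\<close>. The equation of \<open>bij_h_imp_eq\<close> then becomes impossible in the even
  case and a quadratic equation for \<open>T\<close> in the odd case.\<close>

lemma bij_h_imp:
  assumes bij: "bij h" and T2: "T ^ 2 \<noteq> 1"
  shows "odd q" and "T = -3 \<and> 3 ^ ((q - 1) div 2) = (1 :: 'b) \<or>
           T = 3 \<and> (-3) ^ ((q - 1) div 2) = (-1 :: 'b)"
proof -
  define a where "a = - inverse T"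
  have aT: "a * T = -1" using T_nonzero by (simp add: a_def)
  have aq: "a ^ q = a" by (simp add: a_def frob_minus power_inverse T_power)
  have a0: "a \<noteq> 0" using aT by auto
  have a2: "a ^ 2 \<noteq> 1"
  proof
    assume "a ^ 2 = 1"
    moreover have "(a * T) ^ 2 = 1" by (simp add: aT)
    ultimately show False using T2 by (simp add: power_mult_distrib)
  qed
  show odd: "odd q"
  proof
    assume even: "even q"
    hence two: "(2 :: 'b) = 0" by (simp add: two_eq_0_iff)
    have "a ^ (q + 1) = a ^ 2" by (simp add: aq power2_eq_square)
    \<comment> \<open>For even \<open>q\<close> squaring permutes the roots of unity, so
      \<open>m = q + 1\<close>; the right-hand side is 0 in characteristic 2.\<close>
    moreover have "(a + T) * of_nat (q + 1) * a ^ (q + 1) = 2 * a * (a ^ (q + 1) - 1)"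
    proof (rule bij_h_imp_eq[OF bij T2 aT])
      show "((x ^ (q - 1)) ^ 2) ^ (q + 1) = 1" if "x \<noteq> 0" for x :: 'b
        using norm_1[OF that] by (metis power_commutes power_mult power_one mult.commute)
      show "\<not> q + 1 dvd 2 * k" if "0 < k" "k < q + 1" for k
        using that even by (subst coprime_dvd_mult_right_iff) (auto dest: dvd_imp_le)
    qed (use a2 q_gt_2 calculation in auto)
    ultimately have "a + T = 0" using two a0 by (simp add: of_nat_q)
    hence "a = -T" by (simp add: eq_neg_iff_add_eq_0)
    thus False using aT T2 by (simp add: power2_eq_square)
  qed
  define Q where "Q = (q - 1) div 2"
  have qQ: "q = 2 * Q + 1" using odd by (auto simp: Q_def elim!: oddE)
  define e where "e = a ^ Q"
  have "a * e ^ 2 = a ^ q" by (simp add: qQ e_def mult.commute flip: power_mult)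
  hence e2: "e ^ 2 = 1" using aq a0 by simp
  have "a ^ (Q + 1) = a * e" by (simp add: e_def)
  moreover have "a * e \<noteq> 1" using a2 e2 by (metis power_mult_distrib mult.right_neutral power_one)
  \<comment> \<open>For odd \<open>q\<close> the squares form a group of order
    \<open>(q + 1) div 2 = Q + 1\<close>.\<close>
  moreover have "(a + T) * of_nat (Q + 1) * a ^ (Q + 1) = 2 * a * (a ^ (Q + 1) - 1)"
  proof (rule bij_h_imp_eq[OF bij T2 aT])
    show "((x ^ (q - 1)) ^ 2) ^ (Q + 1) = 1" if "x \<noteq> 0" for x :: 'b
    proof -
      have "((x ^ (q - 1)) ^ 2) ^ (Q + 1) = (x ^ (q - 1)) ^ (2 * (Q + 1))" by (rule power_mult [symmetric])
      also have "2 * (Q + 1) = q + 1" by (simp add: qQ)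
      finally show ?thesis using norm_1[OF that] by simp
    qed
    show "\<not> q + 1 dvd 2 * k" if "0 < k" "k < Q + 1" for k
      using that by (auto simp: qQ dest: dvd_imp_le)
  qed (use q_gt_2 qQ calculation in auto)
  ultimately have "(a + T) * of_nat (Q + 1) * e = 2 * (a * e - 1)" using a0 by (simp add: mult.assoc)
  moreover have "2 * of_nat (Q + 1) = (1 :: 'b)"
  proof -
    have "2 * of_nat (Q + 1) = (of_nat (q + 1) :: 'b)" by (simp add: qQ)
    thus ?thesis by (simp add: of_nat_q)
  qed
  moreover have "(a + T) * e * (2 * of_nat (Q + 1)) = 2 * ((a + T) * of_nat (Q + 1) * e)"
    by (simp only: mult_ac)
  ultimately have eq: "(a + T) * e = 4 * (a * e - 1)" by (simp only:) simp
  \<comment> \<open>Multiplying the equation \<open>eq\<close> by \<open>T * e\<close> gives this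
    product modulo \<open>a * T = -1\<close> and \<open>e ^ 2 = 1\<close>; the last two terms are
    the corrections.\<close>
  have "(T + e) * (T + 3 * e) = (a + T) * e * (T * e) - 4 * (a * e - 1) * (T * e)
      - (T ^ 2 - 3 * (a * T) - 3) * (e ^ 2 - 1) + 3 * (1 + a * T)"
    by (simp add: algebra_simps power2_eq_square)
  hence "(T + e) * (T + 3 * e) = 0"
    unfolding eq by (simp add: e2 aT)
  moreover have "T + e \<noteq> 0"
  proof
    assume "T + e = 0"
    hence "T = -e" by (simp add: eq_neg_iff_add_eq_0)
    thus False using T2 e2 by simp
  qed
  ultimately have Te: "T = -3 * e" by (simp add: eq_neg_iff_add_eq_0)
  from e2 have "e = 1 \<or> e = -1" by (simp add: power2_eq_1_iff)
  thus "T = -3 \<and> 3 ^ ((q - 1) div 2) = (1 :: 'b) \<or> T = 3 \<and> (-3) ^ ((q - 1) div 2) = (-1 :: 'b)"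
  proof
    assume e: "e = 1"
    \<comment> \<open>The relation \<open>a * T = -1\<close> makes \<open>a\<close> the inverse of
      3, so \<open>e = a ^ Q\<close> determines \<open>3 ^ Q\<close>.\<close>
    have "(a * 3) ^ Q = 1" using aT Te e by simp
    hence "3 ^ Q = (1 :: 'b)" using e by (simp add: power_mult_distrib flip: e_def)
    thus ?thesis using Te e by (simp add: Q_def)
  next
    assume e: "e = -1"
    have "(a * (-3)) ^ Q = 1" using aT Te e by simp
    hence "- ((-3) ^ Q) = (1 :: 'b)" using e by (simp only: power_mult_distrib flip: e_def) simp
    hence "(-3) ^ Q = (-1 :: 'b)" by (metis minus_minus)
    thus ?thesis using Te e by (simp add: Q_def)
  qed
qed

section \<open>Quadratic character of -3 and 3\<close>

text \<open>If \<open>s ^ 2 = -3\<close>, then \<open>s ^ q = s * (-3) ^ Q\<close>. With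
  \<open>s = 2 w + 1\<close> the sign is read off from whether Frobenius fixes the cube root of
  unity \<open>w\<close> or squares it.\<close>

lemma minus_three_power:
  assumes "odd q" "\<not> 3 dvd q"
  shows "(-3) ^ ((q - 1) div 2) = (if q mod 6 = 1 then 1 else -1 :: 'b)"
proof -
  define Q where "Q = (q - 1) div 2"
  have qQ: "q = 2 * Q + 1" using assms by (auto simp: Q_def elim!: oddE)
  define N where "N = (CARD('b) - 1) div 3"
  have "q mod 3 = 1 \<or> q mod 3 = 2" using assms(2) by presburger
  hence "3 dvd (q - 1) * (q + 1)"
  proof
    assume "q mod 3 = 1"
    hence "3 dvd q - 1" using q_gt_2 by presburger
    thus ?thesis by simp
  next
    assume "q mod 3 = 2"
    hence "3 dvd q + 1" by presburger
    thus ?thesis by (rule dvd_mult)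
  qed
  hence N: "CARD('b) - 1 = N * 3" unfolding N_def card_minus_1 by (rule dvd_div_mult_self [symmetric])
  have "CARD('b) - 1 > 0" unfolding card_minus_1 using q_gt_2 by simp
  hence "0 < N" "N < CARD('b) - 1" unfolding N by linarith+
  from ex_power_neq_1[OF this] obtain c :: 'b where c: "c \<noteq> 0" "c ^ N \<noteq> 1" by blast
  \<comment> \<open>\<open>w\<close> is a primitive cube root of unity, so that \<open>2 w + 1\<close> is a square root of \<open>-3\<close>.\<close>
  define w where "w = c ^ N"
  have w3: "w ^ 3 = 1"
    using finite_field_power_card_minus_1[OF c(1)] unfolding N w_def by (simp only: power_mult)
  have "(w - 1) * (w ^ 2 + w + 1) = w ^ 3 - 1"
    by (simp add: algebra_simps power2_eq_square power3_eq_cube)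
  hence w: "w ^ 2 + w + 1 = 0" using c w3 by (simp add: w_def)
  define s where "s = w + w + 1"
  have "s ^ 2 = 4 * (w ^ 2 + w + 1) - 3"
    by (simp add: s_def algebra_simps power2_eq_square)
  hence s2: "s ^ 2 = -3" using w by simp
  have "(3 :: 'b) \<noteq> 0" using assms by (simp add: three_eq_0_iff)
  hence s0: "s \<noteq> 0" using s2 by auto
  have sq: "s ^ q = w ^ q + w ^ q + 1" by (simp only: s_def frob_add power_one)
  have "s ^ q = s * (-3) ^ Q" by (simp add: qQ power_mult s2)
  moreover have "s ^ q = s * (if q mod 6 = 1 then 1 else -1)"
  proof (cases "q mod 6 = 1")
    case True
    hence "q = 3 * (q div 3) + 1" by presburger
    then obtain j where "q = 3 * j + 1" by blast
    hence "w ^ q = w" by (simp add: power_mult w3)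
    thus ?thesis using True unfolding sq by (simp add: s_def)
  next
    case False
    hence "q mod 6 = 5" using coprime_6_mod_12[OF assms] by auto
    hence "q mod 3 = 2" using mod_mod_cancel[of 3 6 q] by simp
    hence "q = 3 * (q div 3) + 2" by presburger
    then obtain j where "q = 3 * j + 2" by blast
    hence "w ^ q = w ^ 2" by (simp add: power_mult power_add power2_eq_square w3)
    moreover have "w ^ 2 = (w ^ 2 + w + 1) - (w + 1)" by simp
    hence "w ^ 2 = - (w + 1)" unfolding w by simp
    ultimately show ?thesis using False unfolding sq by (simp add: s_def)
  qed
  ultimately have "s * (-3) ^ Q = s * (if q mod 6 = 1 then 1 else -1)" by (rule trans [OF sym])
  thus ?thesis unfolding Q_def mult_left_cancel[OF s0] .
qed

text \<open>The character is multiplicative on \<open>3 = (-1) * (-3)\<close>, and its value at -1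
  depends on \<open>q\<close> modulo 4.\<close>

lemma three_power_eq_1_iff:
  assumes "odd q" "\<not> 3 dvd q"
  shows "3 ^ ((q - 1) div 2) = (1 :: 'b) \<longleftrightarrow> q mod 12 = 1 \<or> q mod 12 = 11"
proof -
  have one: "(1 :: 'b) \<noteq> -1" using two_eq_0_iff assms(1) by (metis one_add_one add.right_inverse)
  have "3 ^ ((q - 1) div 2) = (-1) ^ ((q - 1) div 2) * (-3 :: 'b) ^ ((q - 1) div 2)"
    by (simp flip: power_mult_distrib)
  also have "\<dots> = (if q mod 4 = 1 then 1 else -1) * (if q mod 6 = 1 then 1 else -1)"
  proof -
    have "even ((q - 1) div 2) \<longleftrightarrow> q mod 4 = 1"
    proof -
      obtain k where "q = 2 * k + 1" using assms(1) by (elim oddE)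
      moreover have "even k \<longleftrightarrow> (2 * k + 1) mod 4 = 1" by presburger
      ultimately show ?thesis by simp
    qed
    thus ?thesis by (simp only: minus_three_power[OF assms] minus_one_power_iff)
  qed
  also have "\<dots> = 1 \<longleftrightarrow> (q mod 4 = 1 \<longleftrightarrow> q mod 6 = 1)" using one by auto
  also have "\<dots> \<longleftrightarrow> q mod 12 = 1 \<or> q mod 12 = 11" using coprime_6_mod_12[OF assms] by auto
  finally show ?thesis .
qed

section \<open>Sufficiency and the full classification\<close>

text \<open>Applying Frobenius to \<open>1 + T * z ^ 2 = 0\<close> gives \<open>z ^ 2 = -T\<close>,
  and both together force \<open>T ^ 2 = 1\<close>.\<close>

lemma norm_1_nonzero:
  assumes "T ^ 2 \<noteq> 1" "z ^ (q + 1) = 1"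
  shows "1 + T * z ^ 2 \<noteq> 0"
proof
  assume *: "1 + T * z ^ 2 = 0"
  have "(1 + T * z ^ 2) ^ q = 1 + T ^ q * (z ^ q) ^ 2"
    by (simp add: frob_add power_mult_distrib mult.commute flip: power_mult)
  hence "1 + T * inverse z ^ 2 = 0"
    using * q_gt_2 inverse_eq_frob[OF assms(2)] by (simp add: T_power power_0_left)
  hence "z ^ 2 + T = 0" using inverse_eq_frob(2)[OF assms(2)] by (simp add: field_simps)
  hence "z ^ 2 = -T" by (simp add: eq_neg_iff_add_eq_0)
  hence "T ^ 2 = 1" using * by (simp add: power2_eq_square)
  thus False using assms by simp
qed

text \<open>Division-free form of the action of Frobenius on a square root \<open>D / E\<close> of
  \<open>r\<close>; it also covers \<open>E = 0\<close>.\<close>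

lemma frob_ratio:
  assumes "odd q" "D ^ 2 = r * E ^ 2"
  shows "D ^ q * E = D * r ^ ((q - 1) div 2) * (E :: 'b) ^ q"
proof -
  define Q where "Q = (q - 1) div 2"
  have qQ: "q = 2 * Q + 1" using assms by (auto simp: Q_def elim!: oddE)
  show ?thesis
    unfolding Q_def[symmetric] by (simp add: qQ power_mult assms(2) power_mult_distrib)
qed

lemma bij_h_iff:
  "bij h \<longleftrightarrow> T = 1 \<and> q mod 4 = 1 \<or> T = -3 \<and> (q mod 12 = 1 \<or> q mod 12 = 11) \<or> T = 3 \<and> q mod 6 = 5"
proof
  assume bij: "bij h"
  show "T = 1 \<and> q mod 4 = 1 \<or> T = -3 \<and> (q mod 12 = 1 \<or> q mod 12 = 11) \<or> T = 3 \<and> q mod 6 = 5"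
  proof (cases "T ^ 2 = 1")
    case False
    note odd = bij_h_imp(1)[OF bij False]
    have "\<not> 3 dvd q" using bij_h_imp(2)[OF bij False] T_nonzero three_eq_0_iff by auto
    moreover have "(1 :: 'b) \<noteq> -1" using two_eq_0_iff odd by (metis one_add_one add.right_inverse)
    moreover have "q mod 6 = 5" if "q mod 6 \<noteq> 1" using that coprime_6_mod_12[OF odd] calculation by auto
    ultimately show ?thesis
      using bij_h_imp(2)[OF bij False] odd three_power_eq_1_iff minus_three_power
      by (auto split: if_splits)
  next
    case True
    have "h 1 = 1 + T" by (simp add: h_def)
    hence T1: "T \<noteq> -1" using bij_h_nonzero[OF bij, of 1] by auto
    hence T: "T = 1" using True by (simp add: power2_eq_1_iff)
    hence "(2 :: 'b) \<noteq> 0" using T1 by (metis one_add_one eq_neg_iff_add_eq_0)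
    hence odd: "odd q" by (simp add: two_eq_0_iff)
    have "q mod 4 = 1"
    proof (rule ccontr)
      assume "q mod 4 \<noteq> 1"
      with odd have "q mod 4 = 3" by presburger
      hence "4 dvd q + 1" by presburger
      then obtain j where j: "q + 1 = 4 * j" by auto
      \<comment> \<open>An element of order 2 is -1. Here it is also the square of
        \<open>(c ^ j) ^ (q - 1)\<close>, which makes \<open>c ^ j\<close> a nonzero zero of
        \<open>h\<close>.\<close>
      have N: "CARD('b) - 1 = (j * (q - 1) * 2) * 2" unfolding card_minus_1 j by simp
      have "CARD('b) - 1 > 0" unfolding card_minus_1 using q_gt_2 by simp
      hence "0 < j * (q - 1) * 2" "j * (q - 1) * 2 < CARD('b) - 1" unfolding N by linarith+
      from ex_power_neq_1[OF this] obtain c :: 'b where c: "c \<noteq> 0" "c ^ (j * (q - 1) * 2) \<noteq> 1"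
        by blast
      define s where "s = c ^ (j * (q - 1) * 2)"
      have "s ^ 2 = 1"
        using finite_field_power_card_minus_1[OF c(1)] unfolding N s_def by (simp only: power_mult)
      hence "s = -1" using c by (simp add: s_def power2_eq_1_iff)
      hence "((c ^ j) ^ (q - 1)) ^ 2 = -1" by (simp only: s_def power_mult)
      hence "h (c ^ j) = 0" using T c h_eq_0_iff[of "c ^ j"] by simp
      thus False using bij_h_nonzero[OF bij, of "c ^ j"] c by simp
    qed
    thus ?thesis using T by simp
  qed
next
  assume "T = 1 \<and> q mod 4 = 1 \<or> T = -3 \<and> (q mod 12 = 1 \<or> q mod 12 = 11) \<or> T = 3 \<and> q mod 6 = 5"
  then consider "T = 1" "q mod 4 = 1" | "T = -3" "q mod 12 = 1 \<or> q mod 12 = 11" | "T = 3" "q mod 6 = 5"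
    by blast
  thus "bij h"
  proof cases
    case 1
    have "odd q" using 1(2) by presburger
    hence one: "(1 :: 'b) \<noteq> -1" using two_eq_0_iff by (metis one_add_one add.right_inverse)
    have nz: "1 + T * z ^ 2 \<noteq> 0" if z: "z ^ (q + 1) = 1" for z
    proof
      assume "1 + T * z ^ 2 = 0"
      hence z2: "z ^ 2 = -1" using 1 by (simp add: eq_neg_iff_add_eq_0 add.commute)
      \<comment> \<open>Since \<open>(q + 1) div 2\<close> is odd, \<open>z ^ 2 = -1\<close> would
        give \<open>z ^ (q + 1) = -1\<close>.\<close>
      have *: "q + 1 = 2 * ((q + 1) div 2)" "odd ((q + 1) div 2)" using 1(2) by presburger+
      have "z ^ (q + 1) = (z ^ 2) ^ ((q + 1) div 2)" by (subst *(1)) (rule power_mult)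
      thus False using z z2 *(2) one by simp
    qed
    show ?thesis
    proof (rule bij_hI[OF nz])
      fix z w :: 'b assume zw: "z ^ (q + 1) = 1" "w ^ (q + 1) = 1"
      have "z ^ 2 + z * w + w ^ 2 + T + T * (z * w) ^ 2 - T ^ 2 * (z * w) = (1 + T * z ^ 2) * (1 + T * w ^ 2)"
        using 1(1) by (simp add: algebra_simps)
      thus "z ^ 2 + z * w + w ^ 2 + T + T * (z * w) ^ 2 - T ^ 2 * (z * w) \<noteq> 0"
        using nz zw by simp
    qed
  next
    case 2
    have q: "odd q" "\<not> 3 dvd q"
      using 2(2) dvd_mod_iff[of 2 12 q] dvd_mod_iff[of 3 12 q] by auto
    have two: "(2 :: 'b) \<noteq> 0" using q by (simp add: two_eq_0_iff)
    have "T ^ 2 - 1 = 2 ^ 3" using 2(1) by simp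
    hence T2: "T ^ 2 \<noteq> 1" using two by (metis cancel_comm_monoid_add_class.diff_cancel power_eq_0_iff)
    show ?thesis
    proof (rule bij_hI[OF norm_1_nonzero[OF T2]])
      fix z w :: 'b assume zw: "z ^ (q + 1) = 1" "w ^ (q + 1) = 1" "z \<noteq> w"
      note fr = inverse_eq_frob[OF zw(1)] inverse_eq_frob[OF zw(2)]
      show "z ^ 2 + z * w + w ^ 2 + T + T * (z * w) ^ 2 - T ^ 2 * (z * w) \<noteq> 0"
      proof
        assume "z ^ 2 + z * w + w ^ 2 + T + T * (z * w) ^ 2 - T ^ 2 * (z * w) = 0"
        also have "z ^ 2 + z * w + w ^ 2 + T + T * (z * w) ^ 2 - T ^ 2 * (z * w) = (z - w) ^ 2 - 3 * (z * w + 1) ^ 2"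
          unfolding 2(1) by (simp add: algebra_simps power2_eq_square)
        finally have eq: "(z - w) ^ 2 = 3 * (z * w + 1) ^ 2" by simp
        \<comment> \<open>Inverting \<open>z\<close> and \<open>w\<close> negates the ratio of
          \<open>z - w\<close> to \<open>z * w + 1\<close>, but its square 3 is a square in the
          subfield, so Frobenius should fix it. The product of the two then vanishes, and
          \<open>eq\<close> forces \<open>z = w\<close>.\<close>
        have conj: "(z - w) ^ q * (z * w) = - (z - w)" "(z * w + 1) ^ q * (z * w) = z * w + 1"
          by (simp_all add: frob_diff frob_add power_mult_distrib fr field_simps)
        have ratio: "(z - w) ^ q * (z * w + 1) = (z - w) * (z * w + 1) ^ q"
          using frob_ratio[OF q(1) eq] three_power_eq_1_iff[OF q] 2(2) by simp
        have "- (z - w) * (z * w + 1) = ((z - w) ^ q * (z * w + 1)) * (z * w)"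
          unfolding conj(1)[symmetric] by (simp only: mult_ac)
        also have "\<dots> = (z - w) * ((z * w + 1) ^ q * (z * w))"
          unfolding ratio mult_minus_left by (simp only: mult_ac)
        also have "\<dots> = (z - w) * (z * w + 1)"
          unfolding conj(2) by (simp del: minus_diff_eq)
        finally have "2 * ((z - w) * (z * w + 1)) = 0"
          unfolding mult_minus_left neg_eq_iff_add_eq_0 mult_2 .
        thus False using eq two zw(3) by auto
      qed
    qed
  next
    case 3
    have q: "odd q" "\<not> 3 dvd q"
      using 3(2) dvd_mod_iff[of 2 6 q] dvd_mod_iff[of 3 6 q] by auto
    have two: "(2 :: 'b) \<noteq> 0" using q by (simp add: two_eq_0_iff)
    have "T ^ 2 - 1 = 2 ^ 3" using 3(1) by simp
    hence T2: "T ^ 2 \<noteq> 1" using two by (metis cancel_comm_monoid_add_class.diff_cancel power_eq_0_iff)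
    show ?thesis
    proof (rule bij_hI[OF norm_1_nonzero[OF T2]])
      fix z w :: 'b assume zw: "z ^ (q + 1) = 1" "w ^ (q + 1) = 1" "z \<noteq> w"
      note fr = inverse_eq_frob[OF zw(1)] inverse_eq_frob[OF zw(2)]
      show "z ^ 2 + z * w + w ^ 2 + T + T * (z * w) ^ 2 - T ^ 2 * (z * w) \<noteq> 0"
      proof
        assume "z ^ 2 + z * w + w ^ 2 + T + T * (z * w) ^ 2 - T ^ 2 * (z * w) = 0"
        also have "z ^ 2 + z * w + w ^ 2 + T + T * (z * w) ^ 2 - T ^ 2 * (z * w) = (z - w) ^ 2 + 3 * (z * w - 1) ^ 2"
          unfolding 3(1) by (simp add: algebra_simps power2_eq_square)
        finally have eq: "(z - w) ^ 2 = -3 * (z * w - 1) ^ 2" by (simp add: eq_neg_iff_add_eq_0)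
        \<comment> \<open>Now Frobenius fixes the ratio of \<open>z - w\<close> to
          \<open>z * w - 1\<close>, whereas -3 is a nonsquare in the subfield, so it should be
          negated.\<close>
        have conj: "(z - w) ^ q * (z * w) = - (z - w)" "(z * w - 1) ^ q * (z * w) = - (z * w - 1)"
          by (simp_all add: frob_diff frob_add power_mult_distrib fr field_simps)
        have ratio: "(z - w) ^ q * (z * w - 1) = - ((z - w) * (z * w - 1) ^ q)"
          unfolding frob_ratio[OF q(1) eq] minus_three_power[OF q] by (simp add: 3(2) del: minus_diff_eq)
        have "- (z - w) * (z * w - 1) = ((z - w) ^ q * (z * w - 1)) * (z * w)"
          unfolding conj(1)[symmetric] by (simp only: mult_ac)
        also have "\<dots> = - ((z - w) * ((z * w - 1) ^ q * (z * w)))"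
          unfolding ratio mult_minus_left by (simp only: mult_ac)
        also have "\<dots> = (z - w) * (z * w - 1)"
          unfolding conj(2) by (simp del: minus_diff_eq)
        finally have "2 * ((z - w) * (z * w - 1)) = 0"
          unfolding mult_minus_left neg_eq_iff_add_eq_0 mult_2 .
        thus False using eq two zw(3) by auto
      qed
    qed
  qed
qed

end

section \<open>Transfer to polynomials over the subfield\<close>

theorem theorem1p1:
  fixes q :: nat
    and \<iota> :: "'a :: finite_field \<Rightarrow> 'b :: finite_field"
    and t :: 'a
    and f :: "'a poly"
  assumes "primepow q" and "q > 2"
    and "CARD('a) = q" and "CARD('b) = q ^ 2"
    and "field_hom \<iota>"
    and "t \<noteq> 0"
    and "f = monom 1 (q - 2) + monom t (q ^ 2 - q - 1)"
  shows "permutation_polynomial (map_poly \<iota> f) \<longleftrightarrow>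
    (t = 1 \<and> [q = 1] (mod 4)) \<or>
    (t = -3 \<and> ([int q = 1] (mod 12) \<or> [int q = -1] (mod 12))) \<or>
    (t = 3 \<and> [int q = -1] (mod 6))"
proof -
  interpret field_hom \<iota> by fact
  interpret twisted_cubic q "\<iota> t"
  proof
    have "t ^ q = t" using finite_field_power_card_eq_same[of t] assms(3) by simp
    thus "\<iota> t ^ q = \<iota> t" by (simp flip: hom_power)
  qed (use assms in auto)
  have poly: "poly (map_poly \<iota> f) x = x ^ (q - 2) + \<iota> t * x ^ (q ^ 2 - q - 1)" for x
  proof -
    have "map_poly \<iota> f = monom 1 (q - 2) + monom (\<iota> t) (q ^ 2 - q - 1)"
      unfolding assms(7) by (rule poly_eqI) (simp add: coeff_map_poly hom_distribs)
    thus ?thesis by (simp add: poly_monom)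
  qed
  \<comment> \<open>Field homomorphisms are injective, so the conditions on the image of
    \<open>t\<close> are conditions on \<open>t\<close>.\<close>
  have t: "\<iota> t = 1 \<longleftrightarrow> t = 1" "\<iota> t = 3 \<longleftrightarrow> t = 3" "\<iota> t = -3 \<longleftrightarrow> t = -3"
    using eq_iff[of t 1] eq_iff[of t 3] eq_iff[of t "-3"] by (simp_all add: hom_distribs)
  have mods: "[q = 1] (mod 4) \<longleftrightarrow> q mod 4 = 1" "[int q = 1] (mod 12) \<longleftrightarrow> q mod 12 = 1"
    "[int q = -1] (mod 12) \<longleftrightarrow> q mod 12 = 11" "[int q = -1] (mod 6) \<longleftrightarrow> q mod 6 = 5"
    using zmod_int[of q 12] zmod_int[of q 6] by (auto simp: cong_def)
  show ?thesis
    unfolding permutation_polynomial_def bij_iff[OF poly] bij_h_iff t mods ..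
qed

end
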